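(* Let $A\in\mathbb{R}^{n\times p}$, let $W\in\{0,1\}^{n\times p}$ have at most $t$ zeros in each column, let $k\ge1$, $\epsilon\in(0,1]$, $\epsilon_1\ge0$, and $k'=\frac{6kt}{\epsilon}$. Then for any $L$ with $\|A\circ W-L\|_F^2\le\min_{\text{rank-}k'\ \hat L}\|A\circ W-\hat L\|_F^2+\epsilon_1\|A\|_F^2$, $$\|(A-L)\circ W\|_F^2\le OPT+\epsilon\|A\|_F^2+\epsilon_1\|A\|_F^2,$$ where $OPT=\min_{\text{rank-}k\ \hat L}\|(A-\hat L)\circ W\|_F^2$.
   Context: $\circ$ denotes the entrywise product.
   Formalization: The formal statement assumes t ≥ 1; for t = 0 the claim fails (k' = 0, W all ones, A of rank 1, L = 0, k = 1, ε = 1/2, ε₁ = 0), and a mask without zeros is covered by t = 1. *)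

theory Defs
  imports "HOL-Analysis.Analysis"
begin

(* An n x p matrix is an element of real ^ 'p ^ 'n. The library's product (*) on
   finite Cartesian products is componentwise (the matrix product is **), so at
   this type it is already the entrywise product. *)
abbreviation entrywise_prod :: "real ^ 'p ^ 'n \<Rightarrow> real ^ 'p ^ 'n \<Rightarrow> real ^ 'p ^ 'n"
    (infixl "\<odot>" 70) where
  "A \<odot> B \<equiv> A * B"

lemma entrywise_prod_nth: "(A \<odot> B) $ i $ j = A $ i $ j * B $ i $ j"
  by simp

(* The library norm on this type is the Frobenius norm. *)
lemma norm_eq_Frobenius:
  fixes A :: "real ^ 'p ^ 'n"
  shows "(norm A)\<^sup>2 = (\<Sum>i\<in>UNIV. \<Sum>j\<in>UNIV. (A $ i $ j)\<^sup>2)"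
  by (simp add: norm_vec_def L2_set_def sum_nonneg)

(* Matrices of rank at most r; the bound r is real because 6kt/\<epsilon> need not be an
   integer, and it is not required to be below the dimensions. *)
definition rank_le :: "real \<Rightarrow> (real ^ 'p ^ 'n) set" where
  "rank_le r = {L. real (rank L) \<le> r}"

(* The masked objective need not attain its infimum over matrices of rank at most r
   (mask only the (1,1) entry of [[0,1],[1,0]], with r = 1), so the optimal value is
   the infimum. For r >= 0 it is taken over a nonempty set of reals that is bounded
   below by 0, and it is the minimum whenever a minimum exists. *)
definition masked_opt :: "real \<Rightarrow> real ^ 'p ^ 'n \<Rightarrow> real ^ 'p ^ 'n \<Rightarrow> real" where
  "masked_opt r W A = (INF L \<in> rank_le r. (norm ((A - L) \<odot> W))\<^sup>2)"

definition low_rank_opt :: "real \<Rightarrow> real ^ 'p ^ 'n \<Rightarrow> real" where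
  "low_rank_opt r B = (INF L \<in> rank_le r. (norm (B - L))\<^sup>2)"

end

theory Submission
  imports Defs
begin

text \<open>
  Colour the rows with \<open>B = \<lfloor>6t/\<epsilon>\<rfloor>\<close> colours and shrink the mask to \<open>W' \<le> W\<close> by also deleting
  entry \<open>(i, j)\<close> whenever row \<open>i\<close> shares its colour with some row \<open>i'\<close> such that \<open>W i' j = 0\<close>.
  Rows of equal colour have equal rows in \<open>W'\<close>, so for every \<open>M\<close> of rank at most \<open>k\<close> the matrix
  \<open>M \<odot> W'\<close> has rank at most \<open>Bk \<le> k'\<close>. Compared with the masked cost of \<open>M\<close>, the matrix \<open>M \<odot> W'\<close>
  pays extra only on the additionally deleted entries; a uniformly random colouring deletes each
  entry with probability at most \<open>t/B\<close>, so some colouring costs at most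
  \<open>(t/B) \<parallel>A\<parallel>\<^sup>2 \<le> \<epsilon> \<parallel>A\<parallel>\<^sup>2\<close>.
\<close>

text \<open>Colours are chosen greedily: a new element takes the colour adding the least weight, which
  is at most the average over all colours.\<close>

lemma exists_coloring_monochromatic_weight_le:
  fixes w :: "'a \<Rightarrow> 'a \<Rightarrow> real"
  assumes "finite S" and B: "B \<ge> 1"
    and diag: "\<And>x. w x x = 0"
  shows "\<exists>h. (\<forall>x. h x < B) \<and>
    real B * (\<Sum>x\<in>S. \<Sum>y\<in>S. if h x = h y then w x y else 0) \<le> (\<Sum>x\<in>S. \<Sum>y\<in>S. w x y)"
  using \<open>finite S\<close>
proof (induction S)
  case empty
  show ?case using B by (intro exI[of _ "\<lambda>_. 0"]) auto
next
  case (insert a S)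
  then obtain h where h: "\<And>x. h x < B"
    and mono: "real B * (\<Sum>x\<in>S. \<Sum>y\<in>S. if h x = h y then w x y else 0) \<le> (\<Sum>x\<in>S. \<Sum>y\<in>S. w x y)"
    by blast
  define s where "s y = w a y + w y a" for y
  \<comment> \<open>\<open>q c\<close> is the weight that becomes monochromatic when
    \<open>a\<close> receives colour \<open>c\<close>. Every old element has exactly one colour
    below \<open>B\<close>, so these weights sum to the total of \<open>s\<close>.\<close>
  define q where "q c = (\<Sum>y\<in>S. if h y = c then s y else 0)" for c
  have sum_q: "(\<Sum>c<B. q c) = (\<Sum>y\<in>S. s y)"
    unfolding q_def by (subst sum.swap) (use h in \<open>simp add: sum.delta\<close>)
  obtain c where c: "c < B" and c_le: "real B * q c \<le> (\<Sum>y\<in>S. s y)"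
  proof -
    have "\<exists>c<B. real B * q c \<le> (\<Sum>y\<in>S. s y)"
    proof (rule ccontr)
      assume "\<not> ?thesis"
      then have "(\<Sum>c<B. (\<Sum>y\<in>S. s y)) < (\<Sum>c<B. real B * q c)"
        using B by (intro sum_strict_mono) (auto simp: lessThan_empty_iff)
      then show False
        by (simp add: sum_q flip: sum_distrib_left)
    qed
    then show thesis using that by blast
  qed
  define h' where "h' = h(a := c)"
  have h'_S: "h' y = h y" if "y \<in> S" for y
    using that insert.hyps by (auto simp: h'_def)
  have h'_a: "h' a = c" by (simp add: h'_def)
  have split: "(\<Sum>x\<in>insert a S. \<Sum>y\<in>insert a S. f x y)
      = f a a + (\<Sum>y\<in>S. f a y + f y a) + (\<Sum>x\<in>S. \<Sum>y\<in>S. f x y)" for f :: "'a \<Rightarrow> 'a \<Rightarrow> real"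
    using insert.hyps by (simp add: sum.distrib)
  have "(\<Sum>x\<in>insert a S. \<Sum>y\<in>insert a S. if h' x = h' y then w x y else 0)
      = q c + (\<Sum>x\<in>S. \<Sum>y\<in>S. if h x = h y then w x y else 0)"
    unfolding split q_def s_def
    by (simp add: diag h'_a h'_S cong: sum.cong) (auto intro!: sum.cong)
  then have "real B * (\<Sum>x\<in>insert a S. \<Sum>y\<in>insert a S. if h' x = h' y then w x y else 0)
      \<le> (\<Sum>x\<in>insert a S. \<Sum>y\<in>insert a S. w x y)"
    unfolding split using mono c_le by (simp add: diag s_def distrib_left)
  moreover have "\<forall>x. h' x < B" using h c by (simp add: h'_def)
  ultimately show ?case by blast
qed

lemma rows_eq_range: "rows C = range (($) C)"
  by (auto simp: rows_def row_def image_def)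

text \<open>On one class the mask multiplies every row of \<open>M\<close> by the same vector
  \<open>g c\<close>. This is a linear map, so the image of a row basis of \<open>M\<close> spans
  the results, and the \<open>B\<close> images together have at most \<open>B * rank M\<close>
  elements.\<close>

lemma rank_mask_by_row_class_le:
  fixes M V :: "real ^ 'p ^ 'n" and h :: "'n \<Rightarrow> nat"
  assumes h: "\<And>i. h i < B" and V: "\<And>i. V $ i = g (h i)"
  shows "rank (M \<odot> V) \<le> B * rank M"
proof -
  obtain R where R: "R \<subseteq> rows M" "independent R" "rows M \<subseteq> span R" "card R = dim (rows M)"
    by (rule basis_exists)
  have fin: "finite R"
    using R(2) by (rule independent_imp_finite)
  define T where "T = (\<Union>c<B. (\<lambda>v. v * g c) ` R)"
  have "rows (M \<odot> V) \<subseteq> span T"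
  proof
    fix v assume "v \<in> rows (M \<odot> V)"
    then obtain i where i: "v = M $ i * g (h i)"
      by (auto simp: rows_eq_range V)
    have lin: "linear (\<lambda>v. v * g (h i))"
      by (auto intro!: linearI simp: distrib_right vec_eq_iff)
    have "M $ i \<in> span R"
      using R(3) by (auto simp: rows_eq_range)
    then have "v \<in> span ((\<lambda>v. v * g (h i)) ` R)"
      unfolding i linear_span_image[OF lin] by blast
    also have "\<dots> \<subseteq> span T"
      unfolding T_def using h by (intro span_mono) blast
    finally show "v \<in> span T" .
  qed
  then have "rank (M \<odot> V) \<le> card T"
    unfolding row_rank_def using fin
    by (intro dim_le_card) (auto simp: T_def)
  also have "\<dots> \<le> (\<Sum>c<B. card ((\<lambda>v. v * g c) ` R))"
    unfolding T_def by (rule card_UN_le) simp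
  also have "\<dots> \<le> (\<Sum>c<B. card R)"
    by (intro sum_mono card_image_le fin)
  finally show ?thesis
    using R(4) by (simp add: row_rank_def)
qed

lemma exists_masked_approx:
  fixes A W M :: "real ^ 'p ^ 'n"
  assumes W: "\<And>i j. W $ i $ j \<in> {0, 1}"
    and zeros: "\<And>j. card {i. W $ i $ j = 0} \<le> t"
    and B: "B \<ge> 1"
  obtains N where "rank N \<le> B * rank M"
    and "(norm (A \<odot> W - N))\<^sup>2 \<le> (norm ((A - M) \<odot> W))\<^sup>2 + real t / real B * (norm A)\<^sup>2"
proof -
  \<comment> \<open>\<open>w i i'\<close> is the squared mass that row \<open>i\<close> of
    \<open>A\<close> loses when \<open>i'\<close> has its colour. An entry deleted on account of
    several \<open>i'\<close> is counted once for each: this union bound makes the loss a sum over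
    pairs.\<close>
  define w where "w i i' =
    (\<Sum>j\<in>UNIV. if W $ i $ j = 1 \<and> W $ i' $ j = 0 then (A $ i $ j)\<^sup>2 else 0)" for i i'
  have "w i i = 0" for i by (auto simp: w_def intro!: sum.neutral)
  from exists_coloring_monochromatic_weight_le[where S = UNIV and w = w, OF _ B this]
  obtain h where h: "\<And>i. h i < B"
    and mono: "real B * (\<Sum>i\<in>UNIV. \<Sum>i'\<in>UNIV. if h i = h i' then w i i' else 0)
      \<le> (\<Sum>i\<in>UNIV. \<Sum>i'\<in>UNIV. w i i')"
    by auto
  \<comment> \<open>The witness \<open>i'\<close> may be the row itself, so the mask
    \<open>V\<close> built from \<open>g\<close> vanishes wherever \<open>W\<close> does.\<close>
  define g :: "nat \<Rightarrow> real ^ 'p" where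
    "g c = (\<chi> j. if \<exists>i'. h i' = c \<and> W $ i' $ j = 0 then 0 else 1)" for c
  define V :: "real ^ 'p ^ 'n" where "V = (\<chi> i. g (h i))"

  have entry: "((A \<odot> W - M \<odot> V) $ i $ j)\<^sup>2 \<le> (((A - M) \<odot> W) $ i $ j)\<^sup>2
     + (\<Sum>i'\<in>UNIV. if h i = h i' \<and> W $ i $ j = 1 \<and> W $ i' $ j = 0 then (A $ i $ j)\<^sup>2 else 0)"
    (is "?l \<le> ?r + sum ?f UNIV") for i j
  \<comment> \<open>A newly deleted entry costs exactly the square of the entry of \<open>A\<close>,
    which is one term of the sum. At every other entry \<open>V\<close> and \<open>W\<close>
    agree.\<close>
  proof (cases "W $ i $ j = 1 \<and> (\<exists>i'. h i = h i' \<and> W $ i' $ j = 0)")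
    case True
    then obtain i' where i': "h i = h i'" "W $ i' $ j = 0" by blast
    have "?l = ?f i'" using True i' by (auto simp: V_def g_def)
    also have "\<dots> \<le> sum ?f UNIV" by (rule member_le_sum) auto
    finally show ?thesis by (simp add: add_increasing)
  next
    case False
    have "?l = ?r"
      using False W[of i j] by (auto simp: V_def g_def algebra_simps)
    moreover have "sum ?f UNIV \<ge> 0" by (intro sum_nonneg) auto
    ultimately show ?thesis by linarith
  qed

  have "(\<Sum>i\<in>UNIV. \<Sum>i'\<in>UNIV. w i i')
      = (\<Sum>i\<in>UNIV. \<Sum>j\<in>UNIV. \<Sum>i'\<in>UNIV. if W $ i $ j = 1 \<and> W $ i' $ j = 0 then (A $ i $ j)\<^sup>2 else 0)"
    unfolding w_def by (intro sum.cong refl sum.swap)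
  \<comment> \<open>An entry in column \<open>j\<close> is charged only by rows with a zero in that
    column, of which there are at most \<open>t\<close>.\<close>
  also have "\<dots> \<le> (\<Sum>i\<in>UNIV. \<Sum>j\<in>UNIV. real t * (A $ i $ j)\<^sup>2)"
  proof (intro sum_mono)
    fix i j
    have "(\<Sum>i'\<in>UNIV. if W $ i $ j = 1 \<and> W $ i' $ j = 0 then (A $ i $ j)\<^sup>2 else 0)
        \<le> (\<Sum>i'\<in>UNIV. if W $ i' $ j = 0 then (A $ i $ j)\<^sup>2 else 0)"
      by (intro sum_mono) auto
    also have "\<dots> = real (card {i. W $ i $ j = 0}) * (A $ i $ j)\<^sup>2"
      by (simp add: sum.If_cases)
    also have "\<dots> \<le> real t * (A $ i $ j)\<^sup>2"
      using zeros by (intro mult_right_mono) auto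
    finally show "(\<Sum>i'\<in>UNIV. if W $ i $ j = 1 \<and> W $ i' $ j = 0 then (A $ i $ j)\<^sup>2 else 0)
        \<le> real t * (A $ i $ j)\<^sup>2" .
  qed
  also have "\<dots> = real t * (norm A)\<^sup>2"
    by (simp add: norm_eq_Frobenius sum_distrib_left)
  finally have total: "(\<Sum>i\<in>UNIV. \<Sum>i'\<in>UNIV. w i i') \<le> real t * (norm A)\<^sup>2" .

  have "(norm (A \<odot> W - M \<odot> V))\<^sup>2 \<le> (norm ((A - M) \<odot> W))\<^sup>2
     + (\<Sum>i\<in>UNIV. \<Sum>j\<in>UNIV. \<Sum>i'\<in>UNIV.
          if h i = h i' \<and> W $ i $ j = 1 \<and> W $ i' $ j = 0 then (A $ i $ j)\<^sup>2 else 0)"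
    unfolding norm_eq_Frobenius sum.distrib[symmetric] by (intro sum_mono entry)
  also have "(\<Sum>i\<in>UNIV. \<Sum>j\<in>UNIV. \<Sum>i'\<in>UNIV.
          if h i = h i' \<and> W $ i $ j = 1 \<and> W $ i' $ j = 0 then (A $ i $ j)\<^sup>2 else 0)
      = (\<Sum>i\<in>UNIV. \<Sum>i'\<in>UNIV. if h i = h i' then w i i' else 0)"
    unfolding w_def by (subst sum.swap[of _ UNIV UNIV], intro sum.cong refl) auto
  also have "\<dots> \<le> real t / real B * (norm A)\<^sup>2"
    using order_trans[OF mono total] B by (simp add: field_simps)
  finally show thesis
    by (intro that[of "M \<odot> V"] rank_mask_by_row_class_le[where h = h and g = g])
      (auto simp: h V_def)
qed

lemma low_rank_opt_le:
  assumes "real (rank N) \<le> r"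
  shows "low_rank_opt r C \<le> (norm (C - N))\<^sup>2"
  unfolding low_rank_opt_def using assms
  by (intro cINF_lower bdd_belowI[of _ 0]) (auto simp: rank_le_def)

text \<open>Where \<open>W\<close> is 1 the two differences coincide, and where it is 0 the left one
  vanishes.\<close>

lemma norm_masked_le:
  fixes A W L :: "real ^ 'p ^ 'n"
  assumes W: "\<And>i j. W $ i $ j \<in> {0, 1}"
  shows "(norm ((A - L) \<odot> W))\<^sup>2 \<le> (norm (A \<odot> W - L))\<^sup>2"
  unfolding norm_eq_Frobenius
proof (intro sum_mono)
  fix i j
  show "(((A - L) \<odot> W) $ i $ j)\<^sup>2 \<le> ((A \<odot> W - L) $ i $ j)\<^sup>2"
    using W[of i j] by auto
qed

theorem theorem18:
  fixes A W L :: "real ^ 'p ^ 'n"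
    and k t :: nat
    and \<epsilon> \<epsilon>\<^sub>1 k' :: real
  assumes "\<And>i j. W $ i $ j \<in> {0, 1}"
    and "\<And>j. card {i. W $ i $ j = 0} \<le> t"
    and "t \<ge> 1"
    and "k \<ge> 1"
    and "0 < \<epsilon>" and "\<epsilon> \<le> 1"
    and "\<epsilon>\<^sub>1 \<ge> 0"
    and "k' = 6 * real k * real t / \<epsilon>"
    and "(norm (A \<odot> W - L))\<^sup>2 \<le> low_rank_opt k' (A \<odot> W) + \<epsilon>\<^sub>1 * (norm A)\<^sup>2"
  shows "(norm ((A - L) \<odot> W))\<^sup>2
           \<le> masked_opt (real k) W A + \<epsilon> * (norm A)\<^sup>2 + \<epsilon>\<^sub>1 * (norm A)\<^sup>2"
proof -
  \<comment> \<open>Rounding down keeps \<open>B * k\<close> at most \<open>k'\<close>. It loses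
    less than 1, which is at most \<open>t / \<epsilon>\<close>, so \<open>B\<close> is still at
    least \<open>t / \<epsilon>\<close> and the loss factor \<open>t / B\<close> is at most
    \<open>\<epsilon>\<close>.\<close>
  define B where "B = nat \<lfloor>6 * real t / \<epsilon>\<rfloor>"
  have t_le: "real t \<le> real t / \<epsilon>" and t1: "real t \<ge> 1"
    using assms(3,5,6) by (simp_all add: field_simps mult_left_le)
  then have B_le: "real B \<le> 6 * real t / \<epsilon>" and B_gt: "6 * real t / \<epsilon> < real B + 1"
    unfolding B_def by auto
  have ratio: "real t / \<epsilon> \<le> real B" and B: "B \<ge> 1"
    using B_gt t_le t1 by auto
  have "real t / real B \<le> \<epsilon>"
    using ratio B assms(5) by (simp add: field_simps)
  then have tail: "real t / real B * (norm A)\<^sup>2 \<le> \<epsilon> * (norm A)\<^sup>2"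
    by (rule mult_right_mono) simp
  \<comment> \<open>The infimum may not be attained, so the bound is proved for every competitor
    \<open>M\<close> instead of an optimal one.\<close>
  have "low_rank_opt k' (A \<odot> W) - \<epsilon> * (norm A)\<^sup>2 \<le> masked_opt (real k) W A"
    unfolding masked_opt_def
  proof (rule cINF_greatest)
    have "0 \<in> (rank_le (real k) :: (real ^ 'p ^ 'n) set)"
      by (simp add: rank_le_def)
    then show "(rank_le (real k) :: (real ^ 'p ^ 'n) set) \<noteq> {}" by blast
  next
    fix M :: "real ^ 'p ^ 'n"
    assume "M \<in> rank_le (real k)"
    then have M: "rank M \<le> k" by (simp add: rank_le_def)
    obtain N where N: "rank N \<le> B * rank M"
      and le: "(norm (A \<odot> W - N))\<^sup>2 \<le> (norm ((A - M) \<odot> W))\<^sup>2 + real t / real B * (norm A)\<^sup>2"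
      using exists_masked_approx[OF assms(1,2) B] by blast
    have "real (rank N) \<le> real B * real k"
      using order_trans[OF N mult_le_mono2[OF M]] by (simp flip: of_nat_mult)
    also have "\<dots> \<le> 6 * real t / \<epsilon> * real k"
      using B_le by (rule mult_right_mono) simp
    finally have "real (rank N) \<le> k'"
      by (simp add: assms(8) mult_ac)
    then show "low_rank_opt k' (A \<odot> W) - \<epsilon> * (norm A)\<^sup>2 \<le> (norm ((A - M) \<odot> W))\<^sup>2"
      using low_rank_opt_le[of N k' "A \<odot> W"] le tail by linarith
  qed
  then show ?thesis
    using norm_masked_le[OF assms(1), of A L] assms(9) by linarith
qed

end
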